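(* Let $A,B$ be complex polynomials and let $F,G:\mathbb{C}\mathbb{P}^1\to\mathbb{C}\mathbb{P}^1$ be non-constant continuous functions such that the equality $F(A(z))=G(B(z))$ holds for any $z\in\mathbb{C}\mathbb{P}^1$. Then there exist polynomials $C,D$ such that $$C(A(z))=D(B(z)).$$ Furthermore, there exists a continuous function $H:\mathbb{C}\mathbb{P}^1\to\mathbb{C}\mathbb{P}^1$ such that $$F(z)=H(C(z)),\qquad G(z)=H(D(z)).$$
   Context: $\mathbb{C}\mathbb{P}^1=\mathbb{C}\cup\{\infty\}$ is the Riemann sphere with its usual topology. A complex polynomial is regarded as a continuous map $\mathbb{C}\mathbb{P}^1\to\mathbb{C}\mathbb{P}^1$.
   Formalization: The formal theorem assumes that A and B are not both constant; without this the claim fails, e.g. for A = B = 0, F the identity and G complex conjugation. *)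

theory Defs
  imports "HOL-Analysis.Analysis" "HOL-Computational_Algebra.Polynomial"
begin

text \<open>
  The Riemann sphere as the one-point compactification of the complex plane:
  \<^term>\<open>Some w\<close> is the finite point \<open>w\<close> and \<^term>\<open>None\<close> is the point at infinity.
\<close>

abbreviation riemann_sphere :: "complex option topology" where
  "riemann_sphere \<equiv> Alexandroff_compactification euclidean"

lemma topspace_riemann_sphere: "topspace riemann_sphere = UNIV"
  by (simp add: UNIV_option_conv)

text \<open>
  A constant polynomial has to be extended to infinity by its constant value;
  every other polynomial fixes infinity. This is the only continuous extension.
\<close>

fun sphere_poly :: "complex poly \<Rightarrow> complex option \<Rightarrow> complex option" where
  "sphere_poly p (Some z) = Some (poly p z)"
| "sphere_poly p None = (if degree p = 0 then Some (poly p 0) else None)"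

lemma continuous_map_sphere_poly:
  "continuous_map riemann_sphere riemann_sphere (sphere_poly p)"
proof (cases "degree p = 0")
  case True
  then obtain c where p: "p = [:c:]"
    by (rule degree_eq_zeroE)
  have "sphere_poly p = (\<lambda>_. Some c)"
  proof
    show "sphere_poly p x = Some c" for x
      by (cases x) (simp_all add: p)
  qed
  then show ?thesis
    by simp
next
  case False
  have "openin riemann_sphere (sphere_poly p -` V)" if V: "openin riemann_sphere V" for V
  proof -
    consider U where "open U" "V = Some ` U"
      | K where "compact K" "V = insert None (Some ` (- K))"
      using V by (auto simp: openin_Alexandroff_compactification Compl_eq_Diff_UNIV)
    then show ?thesis
    proof cases
      case 1
      have "sphere_poly p x \<in> V \<longleftrightarrow> x \<in> Some ` (poly p -` U)" for x
        using False 1 by (cases x) auto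
      then have "sphere_poly p -` V = Some ` (poly p -` U)"
        by blast
      then show ?thesis
        using \<open>open U\<close> by (simp add: open_vimage continuous_on_poly)
    next
      case 2
      have "sphere_poly p x \<in> V \<longleftrightarrow> x \<in> insert None (Some ` (- (poly p -` K)))" for x
        using False 2 by (cases x) auto
      then have eq: "sphere_poly p -` V = insert None (Some ` (- (poly p -` K)))"
        by blast
      have "closed (poly p -` K)"
        using 2 by (simp add: closed_vimage continuous_on_poly compact_imp_closed)
      moreover have "bounded (poly p -` K)"
      proof -
        obtain b where b: "\<And>w. w \<in> K \<Longrightarrow> norm w \<le> b"
          using compact_imp_bounded[OF \<open>compact K\<close>] by (auto simp: bounded_iff)
        have "filterlim (poly p) at_infinity at_infinity"
          using False by (intro filterlim_poly_at_infinity) simp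
        then have "\<forall>\<^sub>F z in at_infinity. norm (poly p z) \<ge> \<bar>b\<bar> + 1"
          by (simp add: filterlim_at_infinity[of 0])
        then obtain r where "\<And>z. norm z \<ge> r \<Longrightarrow> norm (poly p z) \<ge> \<bar>b\<bar> + 1"
          by (auto simp: eventually_at_infinity)
        then have "norm z \<le> r" if "poly p z \<in> K" for z
          using b[OF that] by (smt (verit))
        then show ?thesis
          by (auto simp: bounded_iff)
      qed
      ultimately have "compact (poly p -` K)"
        by (simp add: compact_eq_bounded_closed)
      then show ?thesis
        unfolding eq
        by (auto simp: openin_Alexandroff_compactification Compl_eq_Diff_UNIV compact_imp_closed)
    qed
  qed
  then show ?thesis
    by (simp add: continuous_map_alt UNIV_option_conv[symmetric])
qed

end

theory Submission
  imports Defs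
    "HOL-Computational_Algebra.Fundamental_Theorem_Algebra"
    "HOL-Computational_Algebra.Field_as_Ring"
    "HOL-Computational_Algebra.Polynomial_Factorial"
begin

text \<open>
  The preimages \<open>K\<close> under \<open>F\<close> and \<open>L\<close> under \<open>G\<close> of a closed set that misses \<open>F(\<infinity>) = G(\<infinity>)\<close> are
  compact subsets of the plane with \<open>A\<^sup>-\<^sup>1(K) = B\<^sup>-\<^sup>1(L)\<close>. If \<open>C\<close> is a Chebyshev polynomial of \<open>K\<close>, then
  \<open>C \<circ> A\<close> is one of \<open>A\<^sup>-\<^sup>1(K)\<close>, because averaging over the fibres of \<open>A\<close> maps polynomials to
  polynomials without increasing the norm. Likewise for \<open>D\<close>, \<open>L\<close> and \<open>B\<close>, so when the degrees are
  chosen such that both composites have degree \<open>lcm (deg A) (deg B)\<close>, uniqueness of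
  Chebyshev polynomials gives \<open>C \<circ> A = D \<circ> B\<close>. As \<open>C\<close> and \<open>D\<close> have coprime degrees,
  \<open>z \<mapsto> (A(z), B(z))\<close> parametrises the whole curve \<open>C(x) = D(y)\<close>. Hence \<open>C(x) = D(y)\<close>
  implies \<open>F(x) = G(y)\<close>, so \<open>F\<close> factors through the quotient map \<open>C\<close>, and \<open>G\<close> through \<open>D\<close>
  with the same left factor.
\<close>

section \<open>Chebyshev polynomials of compact sets\<close>

lemma poly_interpolation_exists:
  fixes f :: "'a::field \<Rightarrow> 'a"
  assumes "finite E"
  shows "\<exists>g. degree g \<le> card E - 1 \<and> (\<forall>z\<in>E. poly g z = f z)"
  using assms
proof (induction E rule: finite_induct)
  case empty
  then show ?case by (intro exI[of _ 0]) auto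
next
  case (insert e E)
  then obtain g where g: "degree g \<le> card E - 1" "\<And>z. z \<in> E \<Longrightarrow> poly g z = f z"
    by auto
  \<comment> \<open>Newton's form: a multiple of \<open>w\<close>, which vanishes at the old nodes,
    corrects the value at \<open>e\<close>.\<close>
  define w where "w = (\<Prod>z\<in>E. [:- z, 1:])"
  have pw: "poly w x = (\<Prod>z\<in>E. x - z)" for x
    by (simp add: w_def poly_prod)
  have w: "degree w \<le> card E"
    unfolding w_def using degree_prod_sum_le[OF insert.hyps(1), of "\<lambda>z. [:- z, 1:]"] by simp
  have we: "poly w e \<noteq> 0" "\<And>z. z \<in> E \<Longrightarrow> poly w z = 0"
    using insert.hyps by (auto simp: pw)
  define h where "h = g + smult ((f e - poly g e) / poly w e) w"
  have "degree h \<le> card E"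
    unfolding h_def
    by (intro degree_add_le order.trans[OF degree_smult_le w] order.trans[OF g(1)]) auto
  moreover have "poly h z = f z" if "z \<in> insert e E" for z
    using that we g(2) by (auto simp: h_def)
  ultimately show ?case
    using insert.hyps by (intro exI[of _ h]) auto
qed

text \<open>
  This says that \<open>P\<close> is a Chebyshev polynomial of \<open>K\<close>, with \<open>M\<close> its supremum norm: no change of
  its coefficients of index below \<open>k\<close> decreases the norm.
\<close>

definition least_deviation :: "complex set \<Rightarrow> nat \<Rightarrow> complex poly \<Rightarrow> real \<Rightarrow> bool" where
  "least_deviation K k P M \<longleftrightarrow>
     (\<forall>z\<in>K. norm (poly P z) \<le> M) \<and>
     (\<forall>g. degree g < k \<longrightarrow> (\<exists>z\<in>K. M \<le> norm (poly (P + g) z)))"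

text \<open>A compactness argument: a correction of degree \<open>< k\<close> is determined by its
  values at \<open>k\<close> points of \<open>K\<close>, and for nearly optimal corrections these
  values are bounded.\<close>

lemma least_deviation_exists:
  assumes K: "compact K" "infinite K" and k: "k > 0"
  shows "\<exists>g M. degree g < k \<and> least_deviation K k (P + g) M"
proof -
  obtain E where E: "E \<subseteq> K" "finite E" "card E = k"
    using infinite_arbitrarily_large[OF K(2)] by blast
  have "\<exists>L. degree L \<le> card E - 1 \<and> (\<forall>z\<in>E. poly L z = of_bool (z = e))" for e
    by (rule poly_interpolation_exists[OF E(2)])
  then obtain L where L: "\<And>e. degree (L e) \<le> card E - 1"
      "\<And>e z. z \<in> E \<Longrightarrow> poly (L e) z = of_bool (z = e)"
    by metis
  \<comment> \<open>Lagrange's formula: \<open>c\<close> lists the values at the nodes, so functions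
    parametrise the corrections.\<close>
  define comb where "comb c = (\<Sum>e\<in>E. smult (c e) (L e))" for c
  have deg_comb: "degree (comb c) < k" for c
  proof -
    have "degree (comb c) \<le> k - 1"
      unfolding comb_def using L(1) E(3)
      by (intro degree_sum_le E(2)) (metis degree_smult_le order.trans)
    then show ?thesis using k by simp
  qed
  have comb: "comb c = g" if g: "degree g < k" and c: "\<And>e. e \<in> E \<Longrightarrow> c e = poly g e" for g c
  proof (rule poly_eqI_degree[where A = E])
    fix x assume x: "x \<in> E"
    show "poly (comb c) x = poly g x"
      using x E(2) by (simp add: comb_def poly_sum L(2) c of_bool_def if_distrib sum.delta cong: if_cong)
  qed (use g deg_comb E(3) in auto)
  have norm_cont: "continuous_on K (\<lambda>z. norm (poly Q z))" for Q
    by (intro continuous_intros)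
  have attains: "\<exists>z\<in>K. \<forall>y\<in>K. norm (poly Q y) \<le> norm (poly Q z)" for Q
    using continuous_attains_sup[OF K(1) _ norm_cont] K(2) by fastforce
  define ok where "ok M g \<longleftrightarrow> degree g < k \<and> (\<forall>z\<in>K. norm (poly (P + g) z) \<le> M)" for M g
  define MM where "MM = {M. \<exists>g. ok M g}"
  obtain zP where zP: "zP \<in> K" "\<And>y. y \<in> K \<Longrightarrow> norm (poly P y) \<le> norm (poly P zP)"
    using attains by blast
  have "ok (norm (poly P zP)) 0"
    using zP(2) k by (simp add: ok_def)
  then have ne: "MM \<noteq> {}"
    by (auto simp: MM_def)
  have bdd: "bdd_below MM"
  proof (rule bdd_belowI[of _ 0])
    fix M assume "M \<in> MM"
    then obtain g where "norm (poly (P + g) zP) \<le> M"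
      using zP(1) by (auto simp: MM_def ok_def)
    then show "0 \<le> M"
      by (rule order.trans[OF norm_ge_zero])
  qed
  define M0 where "M0 = Inf MM"
  \<comment> \<open>If \<open>P + g\<close> has norm at most \<open>M0 + 1\<close> on
    \<open>K\<close>, then \<open>R\<close> bounds \<open>g\<close> there.\<close>
  define R where "R = M0 + 1 + norm (poly P zP)"
  \<comment> \<open>Coordinates off \<open>E\<close> are frozen at 0, so the box is a product of
    compact sets in the function space and Tychonoff's theorem applies.\<close>
  define S where "S = PiE UNIV (\<lambda>e. if e \<in> E then cball 0 R else {0 :: complex})"
  define T where "T M = {c. \<forall>z\<in>K. norm (poly (P + comb c) z) \<le> M}" for M
  have compS: "compact S"
    using compactin_PiE[of "\<lambda>_. euclidean" UNIV "\<lambda>e. if e \<in> E then cball 0 R else {0 :: complex}"]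
    by (simp add: S_def euclidean_product_topology)
  have closedT: "closed (T M)" for M
  proof -
    have "continuous_on UNIV (\<lambda>c. norm (poly (P + comb c) z))" for z
      unfolding comb_def poly_add poly_sum poly_smult
      by (intro continuous_intros)  auto
    then have "closed {c. norm (poly (P + comb c) z) \<le> M}" for z
      by (rule closed_Collect_le) simp
    moreover have "T M = (\<Inter>z\<in>K. {c. norm (poly (P + comb c) z) \<le> M})"
      by (auto simp: T_def)
    ultimately show ?thesis by auto
  qed
  have fip: "S \<inter> (\<Inter>M\<in>I. T M) \<noteq> {}" if I: "finite I" "I \<subseteq> {M0<..}" for I
  proof -
    \<comment> \<open>The extra element \<open>M0 + 1\<close> covers empty \<open>I\<close> and
      keeps the values of \<open>g\<close> within the bound \<open>R\<close>.\<close>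
    define m where "m = Min (insert (M0 + 1) I)"
    have "M0 < m"
      using I by (auto simp: m_def)
    then obtain M where "M < m" "M \<in> MM"
      using cInf_lessD[OF ne] unfolding M0_def by blast
    then obtain g where M: "M < m" "ok M g"
      by (auto simp: MM_def)
    define c where "c e = (if e \<in> E then poly g e else 0)" for e
    have cg: "comb c = g"
      using M(2) by (intro comb) (auto simp: ok_def c_def)
    have "norm (poly g e) \<le> R" if "e \<in> E" for e
    proof -
      have "e \<in> K"
        using that E(1) by auto
      then have "norm (poly P e) \<le> norm (poly P zP)" "norm (poly P e + poly g e) \<le> M"
        using zP(2) M(2) by (auto simp: ok_def)
      moreover have "M \<le> M0 + 1"
        using M(1) I(1) by (simp add: m_def)
      moreover have "norm (poly g e) \<le> norm (poly P e + poly g e) + norm (poly P e)"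
        by (metis add_diff_cancel_left' norm_triangle_ineq4)
      ultimately show ?thesis
        by (simp add: R_def)
    qed
    then have "c \<in> S"
      by (auto simp: S_def c_def)
    moreover have "c \<in> T M'" if "M' \<in> I" for M'
    proof -
      have "m \<le> M'"
        using that I(1) by (simp add: m_def)
      then show ?thesis
        using M by (force simp: T_def cg ok_def)
    qed
    ultimately show ?thesis by blast
  qed
  have "S \<inter> (\<Inter>M\<in>{M0<..}. T M) \<noteq> {}"
    using compS closedT fip by (rule compact_imp_fip_image)
  then obtain c where "\<And>M. M > M0 \<Longrightarrow> c \<in> T M"
    by blast
  then have c: "norm (poly (P + comb c) z) \<le> M" if "z \<in> K" "M > M0" for z M
    using that unfolding T_def by blast
  have "least_deviation K k (P + comb c) M0"
    unfolding least_deviation_def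
  proof (intro conjI ballI allI impI)
    fix z assume "z \<in> K"
    then show "norm (poly (P + comb c) z) \<le> M0"
      using c by (metis dense_ge)
  next
    fix g :: "complex poly" assume g: "degree g < k"
    obtain z where z: "z \<in> K" "\<And>y. y \<in> K \<Longrightarrow> norm (poly (P + comb c + g) y) \<le> norm (poly (P + comb c + g) z)"
      using attains by blast
    have "ok (norm (poly (P + comb c + g) z)) (comb c + g)"
      unfolding ok_def add.assoc[symmetric] using z(2) degree_add_less[OF deg_comb g] by blast
    then have "norm (poly (P + comb c + g) z) \<in> MM"
      unfolding MM_def by blast
    then have "M0 \<le> norm (poly (P + comb c + g) z)"
      unfolding M0_def by (rule cInf_lower[OF _ bdd])
    then show "\<exists>z\<in>K. M0 \<le> norm (poly (P + comb c + g) z)"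
      using z(1) by blast
  qed
  then show ?thesis
    using deg_comb by blast
qed

text \<open>Strict convexity of the norm, from the parallelogram law.\<close>

lemma norm_eq_imp_eq_if_norm_add:
  fixes x y :: "'a::real_inner"
  assumes "norm x \<le> M" "norm y \<le> M" "norm (x + y) \<ge> 2 * M"
  shows "x = y"
proof -
  have "0 \<le> M"
    using assms(1) norm_ge_zero order.trans by blast
  have "(norm (x + y))\<^sup>2 \<ge> (2 * M)\<^sup>2"
    using assms(3) \<open>0 \<le> M\<close> by (intro power_mono) auto
  moreover have "(norm x)\<^sup>2 \<le> M\<^sup>2" "(norm y)\<^sup>2 \<le> M\<^sup>2"
    using assms by (auto intro: power_mono)
  moreover have "(norm (x + y))\<^sup>2 + (norm (x - y))\<^sup>2 = 2 * (norm x)\<^sup>2 + 2 * (norm y)\<^sup>2"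
    by (simp add: power2_norm_eq_inner inner_simps inner_commute)
  moreover have "(2 * M)\<^sup>2 = 4 * M\<^sup>2"
    by simp
  ultimately have "(norm (x - y))\<^sup>2 \<le> 0"
    by linarith
  then show ?thesis
    by simp
qed

text \<open>
  If the error attained its maximum at fewer than \<open>k\<close> points, it could be interpolated there
  by a correction of degree \<open>< k\<close>, and subtracting a small multiple of it would lower the maximum.
\<close>

lemma least_deviation_extremal_points:
  assumes K: "compact K" "infinite K" and P: "least_deviation K k P M"
    and E: "finite {z \<in> K. norm (poly P z) \<ge> M}"
  shows "card {z \<in> K. norm (poly P z) \<ge> M} \<ge> k"
proof (rule ccontr)
  define E where "E = {z \<in> K. norm (poly P z) \<ge> M}"
  assume "\<not> ?thesis"
  then have card: "card E < k"
    by (simp add: E_def)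
  have finE: "finite E"
    using E by (simp add: E_def)
  obtain g where g: "degree g \<le> card E - 1" "\<And>z. z \<in> E \<Longrightarrow> poly g z = poly P z"
    using poly_interpolation_exists[OF finE] by blast
  \<comment> \<open>Otherwise every point of \<open>K\<close> would be extremal, but
    \<open>K\<close> is infinite.\<close>
  have "0 < M"
  proof (rule ccontr)
    assume "\<not> 0 < M"
    then have "M \<le> norm (poly P z)" for z
      by (intro order.trans[OF _ norm_ge_zero]) simp
    then have "E = K"
      by (auto simp: E_def)
    then show False
      using finE K(2) by simp
  qed
  have leM: "norm (poly P z) \<le> M" if "z \<in> K" for z
    using P that by (simp add: least_deviation_def)
  \<comment> \<open>The points where subtracting all of \<open>g\<close> leaves a large error. They
    avoid \<open>E\<close>, where \<open>P - g\<close> vanishes, so by compactness the error of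
    \<open>P\<close> stays away from \<open>M\<close> on \<open>K'\<close>.\<close>
  define K' where "K' = {z \<in> K. norm (poly (P - g) z) \<ge> M}"
  have "closed {z. norm (poly (P - g) z) \<ge> M}"
    by (intro closed_Collect_le continuous_intros)
  then have "compact (K \<inter> {z. norm (poly (P - g) z) \<ge> M})"
    by (rule compact_Int_closed[OF K(1)])
  then have K': "compact K'"
    by (simp add: K'_def Int_def)
  have lt: "norm (poly P z) < M" if "z \<in> K'" for z
    using that g(2) \<open>0 < M\<close> by (force simp: K'_def E_def)
  have "\<exists>\<epsilon>>0. \<epsilon> \<le> 1 \<and> (\<forall>z\<in>K'. norm (poly P z) + \<epsilon> * norm (poly g z) < M)"
  proof (cases "K' = {}")
    case True
    then show ?thesis by (intro exI[of _ 1]) auto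
  next
    case False
    have "continuous_on K' (\<lambda>z. norm (poly P z))" "continuous_on K' (\<lambda>z. norm (poly g z))"
      by (intro continuous_intros)+
    then obtain z1 z2 where z1: "z1 \<in> K'" "\<And>z. z \<in> K' \<Longrightarrow> norm (poly P z) \<le> norm (poly P z1)"
      and z2: "\<And>z. z \<in> K' \<Longrightarrow> norm (poly g z) \<le> norm (poly g z2)"
      using continuous_attains_sup[OF K' False] by metis
    define \<delta> where "\<delta> = M - norm (poly P z1)"
    define N where "N = norm (poly g z2) + 1"
    have pos: "\<delta> > 0" "N > 0"
      using lt[OF z1(1)] by (auto simp: \<delta>_def N_def intro: add_nonneg_pos)
    define \<epsilon> where "\<epsilon> = min 1 (\<delta> / N)"
    have \<epsilon>: "0 < \<epsilon>" "\<epsilon> \<le> 1" "\<epsilon> * N \<le> \<delta>"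
      using pos by (auto simp: \<epsilon>_def min_def field_simps)
    have "norm (poly P z) + \<epsilon> * norm (poly g z) < M" if "z \<in> K'" for z
    proof -
      have "\<epsilon> * norm (poly g z) < \<epsilon> * N"
        using z2[OF that] \<epsilon>(1) by (simp add: N_def)
      then show ?thesis
        using \<epsilon>(3) z1(2)[OF that] by (simp add: \<delta>_def)
    qed
    then show ?thesis
      using \<epsilon> by blast
  qed
  then obtain \<epsilon> where \<epsilon>: "\<epsilon> > 0" "\<epsilon> \<le> 1"
      "\<And>z. z \<in> K' \<Longrightarrow> norm (poly P z) + \<epsilon> * norm (poly g z) < M"
    by blast
  define c where "c = complex_of_real \<epsilon>"
  have "degree (- smult c g) < k"
    using g(1) card by (metis degree_minus degree_smult_le diff_le_self le_less_trans)
  then obtain z where z: "z \<in> K" "M \<le> norm (poly (P + - smult c g) z)"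
    using P unfolding least_deviation_def by blast
  have "norm (poly (P + - smult c g) z) < M"
  proof (cases "z \<in> K'")
    case True
    have "norm (poly (P + - smult c g) z) \<le> norm (poly P z) + \<epsilon> * norm (poly g z)"
      using norm_triangle_ineq4[of "poly P z" "c * poly g z"] \<epsilon>(1) by (simp add: c_def norm_mult)
    then show ?thesis
      using \<epsilon>(3)[OF True] by simp
  next
    case False
    then have "norm (poly (P - g) z) < M"
      using z(1) by (simp add: K'_def)
    \<comment> \<open>Off \<open>K'\<close> the new error is a convex combination of the old one, at
      most \<open>M\<close>, and that of \<open>P - g\<close>, strictly below
      \<open>M\<close>.\<close>
    moreover have "poly (P + - smult c g) z = (1 - c) * poly P z + c * poly (P - g) z"
      by (simp add: algebra_simps)
    then have "norm (poly (P + - smult c g) z) \<le> norm ((1 - c) * poly P z) + norm (c * poly (P - g) z)"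
      by (metis norm_triangle_ineq)
    moreover have "norm ((1 - c) * poly P z) = (1 - \<epsilon>) * norm (poly P z)"
      using \<epsilon> by (metis abs_of_nonneg c_def diff_ge_0_iff_ge norm_mult norm_of_real of_real_1 of_real_diff)
    moreover have "norm (c * poly (P - g) z) = \<epsilon> * norm (poly (P - g) z)"
      using \<epsilon> by (simp add: c_def norm_mult)
    moreover have "(1 - \<epsilon>) * norm (poly P z) \<le> (1 - \<epsilon>) * M"
      using \<epsilon> leM[OF z(1)] by (intro mult_left_mono) auto
    ultimately have "norm (poly (P + - smult c g) z) \<le> (1 - \<epsilon>) * M + \<epsilon> * norm (poly (P - g) z)"
      and "\<epsilon> * norm (poly (P - g) z) < \<epsilon> * M"
      using \<epsilon>(1) by auto
    then show ?thesis
      by (simp add: algebra_simps)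
  qed
  then show False
    using z(2) by simp
qed

text \<open>Both norms agree, and the midpoint \<open>R\<close> is again a minimiser. At its
  extremal points strict convexity makes \<open>P\<close> and \<open>Q\<close> equal; there are at
  least \<open>k\<close> of them if finitely many, but \<open>P - Q\<close> has fewer than
  \<open>k\<close> roots.\<close>

lemma least_deviation_unique:
  assumes K: "compact K" "infinite K"
    and P: "least_deviation K k P M" and Q: "least_deviation K k Q N"
    and deg: "degree (P - Q) < k"
  shows "P = Q"
proof (rule ccontr)
  assume "P \<noteq> Q"
  have "N \<le> M"
  proof -
    obtain z where "z \<in> K" "N \<le> norm (poly (Q + (P - Q)) z)"
      using Q deg unfolding least_deviation_def by blast
    then show ?thesis
      using P by (fastforce simp: least_deviation_def)
  qed
  moreover have "M \<le> N"
  proof -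
    have "degree (Q - P) < k"
      using deg degree_minus[of "P - Q"] by simp
    then obtain z where "z \<in> K" "M \<le> norm (poly (P + (Q - P)) z)"
      using P unfolding least_deviation_def by blast
    then show ?thesis
      using Q by (fastforce simp: least_deviation_def)
  qed
  ultimately have [simp]: "N = M"
    by simp
  define R where "R = smult (1/2) (P + Q)"
  have bP: "norm (poly P z) \<le> M" and bQ: "norm (poly Q z) \<le> M" if "z \<in> K" for z
    using P Q that by (auto simp: least_deviation_def)
  have nR: "norm (poly R z) = norm (poly P z + poly Q z) / 2" for z
    by (simp add: R_def norm_mult)
  have R: "least_deviation K k R M"
    unfolding least_deviation_def
  proof (intro conjI ballI allI impI)
    fix z assume "z \<in> K"
    then show "norm (poly R z) \<le> M"
      using bP bQ norm_triangle_ineq[of "poly P z" "poly Q z"] unfolding nR by fastforce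
  next
    fix g :: "complex poly" assume g: "degree g < k"
    have "R + g = P + (smult (- (1/2)) (P - Q) + g)"
      by (simp add: R_def poly_eq_poly_eq_iff[symmetric] fun_eq_iff algebra_simps)
    moreover have "degree (smult (- (1/2)) (P - Q) + g) < k"
      using g deg by (intro degree_add_less) auto
    ultimately show "\<exists>z\<in>K. M \<le> norm (poly (R + g) z)"
      using P unfolding least_deviation_def by metis
  qed
  have sub: "{z \<in> K. norm (poly R z) \<ge> M} \<subseteq> {z. poly (P - Q) z = 0}"
    using norm_eq_imp_eq_if_norm_add[OF bP bQ] by (auto simp: nR)
  have fin: "finite {z. poly (P - Q) z = 0}"
    using \<open>P \<noteq> Q\<close> by (intro poly_roots_finite) auto
  have "k \<le> card {z \<in> K. norm (poly R z) \<ge> M}"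
    by (intro least_deviation_extremal_points K R finite_subset[OF sub fin])
  also have "\<dots> \<le> card {z. poly (P - Q) z = 0}"
    by (intro card_mono fin sub)
  also have "\<dots> \<le> degree (P - Q)"
    using \<open>P \<noteq> Q\<close> by (intro card_poly_roots_bound) auto
  finally show False
    using deg by simp
qed

section \<open>Sums over the fibres of a polynomial\<close>

lemma synthetic_div_linear_mult:
  fixes q :: "'a::comm_ring_1 poly"
  shows "synthetic_div ([:- c, 1:] * q) c = q"
  using synthetic_div_unique[of "[:- c, 1:] * q" c q 0] by simp

lemma synthetic_div_linear_mult_root:
  fixes q :: "'a::comm_ring_1 poly"
  assumes "poly q c = 0"
  shows "synthetic_div ([:- w, 1:] * q) c = [:- w, 1:] * synthetic_div q c"
proof -
  have "q = [:- c, 1:] * synthetic_div q c"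
    using synthetic_div_correct'[of c q] assms by simp
  then have "[:- w, 1:] * q = [:- c, 1:] * ([:- w, 1:] * synthetic_div q c)"
    by (metis mult.left_commute)
  then show ?thesis
    by (metis synthetic_div_linear_mult)
qed

text \<open>The product rule: the quotient by a root \<open>v\<close> is the product with one factor
  of \<open>v\<close> left out. The multiset accounts for repeated roots.\<close>

lemma pderiv_prod_mset_linear:
  fixes Z :: "'a::idom multiset"
  shows "pderiv (\<Prod>w\<in>#Z. [:- w, 1:]) = (\<Sum>v\<in>#Z. synthetic_div (\<Prod>w\<in>#Z. [:- w, 1:]) v)"
proof (induction Z)
  case empty
  then show ?case by simp
next
  case (add w Z)
  define Q where "Q = (\<Prod>w\<in>#Z. [:- w, 1:])"
  have "poly Q v = 0" if "v \<in># Z" for v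
    using that by (auto simp: Q_def poly_prod_mset prod_mset_zero_iff)
  then have "(\<Sum>v\<in>#Z. synthetic_div ([:- w, 1:] * Q) v) = (\<Sum>v\<in>#Z. [:- w, 1:] * synthetic_div Q v)"
    by (intro arg_cong[of _ _ sum_mset] image_mset_cong synthetic_div_linear_mult_root)
  also have "\<dots> = [:- w, 1:] * pderiv Q"
    unfolding sum_mset_distrib_left[symmetric] using add by (simp add: Q_def)
  finally have "(\<Sum>v\<in>#add_mset w Z. synthetic_div ([:- w, 1:] * Q) v) = Q + [:- w, 1:] * pderiv Q"
    using synthetic_div_linear_mult[of w Q] by simp
  moreover have "pderiv ([:- w, 1:] * Q) = Q + [:- w, 1:] * pderiv Q"
    by (simp only: pderiv_mult) (simp add: pderiv_pCons)
  ultimately show ?case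
    by (simp add: Q_def)
qed

text \<open>Horner's scheme: the partial evaluations of \<open>p\<close> at \<open>c\<close> are the
  coefficients of the quotient, which are therefore polynomials in \<open>c\<close>.\<close>

lemma coeff_synthetic_div: "coeff (synthetic_div p c) r = poly (poly_shift (Suc r) p) c"
proof (induction p arbitrary: r)
  case 0
  then show ?case by simp
next
  case (pCons a p)
  have *: "poly_shift (Suc r) (pCons a p) = poly_shift r p" for r
    by (intro poly_eqI) (simp add: coeff_poly_shift)
  show ?case
    by (cases r) (simp_all add: * pCons.IH)
qed

lemma synthetic_div_diff_const:
  fixes p :: "'a::comm_ring_1 poly"
  shows "synthetic_div (p - [:x:]) c = synthetic_div p c"
  by (cases p) simp

lemma synthetic_div_smult: "synthetic_div (smult a p) c = smult a (synthetic_div p c)"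
  by (induction p) simp_all

text \<open>The trace from polynomials in \<open>z\<close> to polynomials in \<open>A\<close>,
  evaluated at \<open>x\<close>. The multiset of roots counts ramified points with
  multiplicity.\<close>

definition fibre_sum :: "complex poly \<Rightarrow> complex poly \<Rightarrow> complex \<Rightarrow> complex" where
  "fibre_sum A g x = (\<Sum>w\<in>#proots (A - [:x:]). poly g w)"

lemma fibre_sum_add: "fibre_sum A (g + h) x = fibre_sum A g x + fibre_sum A h x"
  by (simp add: fibre_sum_def sum_mset.distrib)

lemma fibre_sum_smult: "fibre_sum A (smult c g) x = c * fibre_sum A g x"
  by (simp add: fibre_sum_def sum_mset_distrib_left)

lemma fibre_sum_0 [simp]: "fibre_sum A 0 x = 0"
  by (simp add: fibre_sum_def)

lemma in_proots_diff_const: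
  assumes "degree A > 0" "w \<in># proots (A - [:x:])"
  shows "poly A w = x"
proof -
  have "A - [:x:] \<noteq> 0"
    using assms(1) by auto
  then show ?thesis
    using assms(2) by (simp add: set_count_proots)
qed

text \<open>On the fibre of \<open>x\<close> the factor \<open>pcompose h A\<close> is constant, so
  the trace is linear over polynomials in \<open>A\<close>.\<close>

lemma fibre_sum_mult:
  assumes "degree A > 0"
  shows "fibre_sum A (g * pcompose h A) x = poly h x * fibre_sum A g x"
proof -
  have "(\<Sum>w\<in>#proots (A - [:x:]). poly (g * pcompose h A) w)
        = (\<Sum>w\<in>#proots (A - [:x:]). poly h x * poly g w)"
    using in_proots_diff_const[OF assms]
    by (intro arg_cong[of _ _ sum_mset] image_mset_cong) (simp add: poly_pcompose mult.commute)
  then show ?thesis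
    by (simp add: fibre_sum_def sum_mset_distrib_left)
qed

lemma size_proots_diff_const:
  fixes A :: "complex poly"
  shows "size (proots (A - [:x:])) = degree A"
proof -
  have "degree (A - [:x:]) = degree A"
    by (cases A) simp
  then show ?thesis
    by (simp add: size_proots_complex)
qed

lemma coeff_sum_mset_image: "coeff (\<Sum>v\<in>#Z. f v) r = (\<Sum>v\<in>#Z. coeff (f v) r)"
  by (induction Z) simp_all

text \<open>
  This is a form of Newton's identities: writing \<open>A - x = a \<Prod>(t - w)\<close>, the derivative
  \<open>A'\<close> is the sum of the quotients \<open>(A - x) / (t - w)\<close>, whose coefficients are
  polynomials in \<open>w\<close> independent of \<open>x\<close>.
\<close>

lemma fibre_sum_poly_shift:
  assumes "degree A > 0"
  shows "fibre_sum A (poly_shift (Suc r) A) x = coeff (pderiv A) r"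
proof -
  define P where "P = A - [:x:]"
  have "P \<noteq> 0"
    using assms by (auto simp: P_def)
  define Q where "Q = (\<Prod>w\<in>#proots P. [:- w, 1:])"
  have P: "P = smult (lead_coeff P) Q"
    using complex_poly_decompose_multiset[of P] by (simp add: Q_def)
  have "pderiv A = pderiv P"
    by (simp add: P_def pderiv_diff pderiv_pCons)
  also have "\<dots> = smult (lead_coeff P) (pderiv Q)"
    by (metis P pderiv_smult)
  also have "pderiv Q = (\<Sum>v\<in>#proots P. synthetic_div Q v)"
    unfolding Q_def by (rule pderiv_prod_mset_linear)
  also have "smult (lead_coeff P) \<dots> = (\<Sum>v\<in>#proots P. synthetic_div P v)"
  proof -
    have "synthetic_div P v = [:lead_coeff P:] * synthetic_div Q v" for v
      using P synthetic_div_smult[of "lead_coeff P" Q v] by simp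
    then show ?thesis
      by (simp only: sum_mset_distrib_left[symmetric]) simp
  qed
  also have "\<dots> = (\<Sum>v\<in>#proots P. synthetic_div A v)"
    by (simp add: P_def synthetic_div_diff_const)
  finally have "coeff (pderiv A) r = (\<Sum>v\<in>#proots P. coeff (synthetic_div A v) r)"
    by (simp add: coeff_sum_mset_image)
  then show ?thesis
    by (simp add: fibre_sum_def P_def coeff_synthetic_div)
qed

text \<open>The shifts of \<open>A\<close> realise every degree below \<open>degree A\<close>, and
  by \<open>fibre_sum_poly_shift\<close> their sums do not depend on the fibre. Removing leading
  terms reduces \<open>g\<close> to them.\<close>

lemma fibre_sum_const:
  assumes "degree g < degree A"
  shows "fibre_sum A g x = fibre_sum A g y"
  using assms
proof (induction "degree g" arbitrary: g rule: less_induct)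
  case less
  define n where "n = degree A"
  define j where "j = degree g"
  have j: "j < n"
    using less.prems by (simp add: j_def n_def)
  \<comment> \<open>Shifting by \<open>n - j\<close> leaves degree \<open>j\<close>, the degree of
    \<open>g\<close>.\<close>
  define h where "h = poly_shift (Suc (n - Suc j)) A"
  have ch: "coeff h i = coeff A (i + (n - j))" for i
    using j by (simp add: h_def coeff_poly_shift Suc_diff_Suc)
  have hx: "fibre_sum A h x = fibre_sum A h y"
    unfolding h_def using less.prems by (subst (1 2) fibre_sum_poly_shift) auto
  define c where "c = lead_coeff g / lead_coeff A"
  define g' where "g' = g - smult c h"
  have "lead_coeff A \<noteq> 0"
    using less.prems by auto
  then have cg': "coeff g' i = 0" if "i \<ge> j" for i
  proof (cases "i = j")
    case True
    then show ?thesis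
      using j \<open>lead_coeff A \<noteq> 0\<close> by (simp add: g'_def ch c_def n_def j_def)
  next
    case False
    then show ?thesis
      using that j by (simp add: g'_def ch coeff_eq_0 n_def j_def)
  qed
  \<comment> \<open>A constant \<open>g\<close> is reduced to zero at once, with no smaller degree
    to induct on; hence the case split.\<close>
  have "fibre_sum A g' x = fibre_sum A g' y"
  proof (cases "g' = 0")
    case True
    then show ?thesis by simp
  next
    case False
    then have "degree g' < j"
      using cg' by (intro degree_lessI) auto
    then show ?thesis
      using less j by (simp add: j_def n_def)
  qed
  moreover have "g = g' + smult c h"
    by (simp add: g'_def)
  ultimately show ?case
    using hx by (simp add: fibre_sum_add fibre_sum_smult)
qed

text \<open>Division \<open>g = q * A + r\<close> turns the sum of \<open>g\<close> at
  \<open>x\<close> into \<open>x\<close> times that of \<open>q\<close> plus a constant.\<close>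

lemma fibre_sum_poly:
  assumes "degree A > 0" "degree g < Suc k * degree A"
  shows "\<exists>h. degree h \<le> k \<and> (\<forall>x. fibre_sum A g x = poly h x)"
  using assms(2)
proof (induction k arbitrary: g)
  case 0
  then have "fibre_sum A g x = poly [:fibre_sum A g 0:] x" for x
    using fibre_sum_const[of g A x 0] by simp
  then show ?case
    by (intro exI[of _ "[:fibre_sum A g 0:]"]) simp
next
  case (Suc k)
  define q r where "q = g div A" and "r = g mod A"
  have g: "g = q * A + r"
    by (simp add: q_def r_def)
  have r: "degree r < degree A"
    unfolding r_def using assms(1) by (metis degree_0 degree_mod_less less_numeral_extra(3))
  have "degree q < Suc k * degree A"
  proof (cases "q = 0")
    case True
    then show ?thesis using assms(1) by simp
  next
    case False
    have "degree (q * A) < Suc (Suc k) * degree A"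
      using degree_diff_less[OF Suc.prems, of r] r g by simp
    then show ?thesis
      using False assms(1) by (subst (asm) degree_mult_eq) auto
  qed
  then obtain h where h: "degree h \<le> k" "\<And>x. fibre_sum A q x = poly h x"
    using Suc.IH by blast
  have "fibre_sum A g x = poly (pCons (fibre_sum A r 0) h) x" for x
    using fibre_sum_mult[OF assms(1), of q "[:0, 1:]" x] fibre_sum_const[OF r, of x 0] h(2)
    by (simp add: g fibre_sum_add pcompose_pCons)
  moreover have "degree (pCons (fibre_sum A r 0) h) \<le> Suc k"
    using h(1) degree_pCons_le[of "fibre_sum A r 0" h] by linarith
  ultimately show ?case
    by blast
qed

lemma norm_sum_mset_less:
  fixes f :: "'a \<Rightarrow> 'b::real_normed_vector"
  assumes "\<And>w. w \<in># Z \<Longrightarrow> norm (f w) < M" "Z \<noteq> {#}"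
  shows "norm (\<Sum>w\<in>#Z. f w) < real (size Z) * M"
  using assms
proof (induction Z)
  case empty
  then show ?case by simp
next
  case (add x Z)
  show ?case
  proof (cases "Z = {#}")
    case True
    then show ?thesis using add by simp
  next
    case False
    have "norm (\<Sum>w\<in>#add_mset x Z. f w) \<le> norm (f x) + norm (\<Sum>w\<in>#Z. f w)"
      by (simp add: norm_triangle_ineq)
    also have "\<dots> < M + real (size Z) * M"
      using add False by (intro add_strict_mono) auto
    finally show ?thesis
      by (simp add: algebra_simps)
  qed
qed

text \<open>The average of \<open>pcompose T A + g\<close> over the fibre of \<open>x\<close> is the
  value at \<open>x\<close> of \<open>T\<close> plus a correction of degree \<open>< k\<close>. For
  some \<open>x\<close> in \<open>K\<close> it has norm at least \<open>M\<close>, so some point of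
  that fibre does too.\<close>

lemma least_deviation_pcompose:
  assumes T: "least_deviation K k T M" and A: "degree A > 0"
  shows "least_deviation (poly A -` K) (k * degree A) (pcompose T A) M"
  unfolding least_deviation_def
proof (intro conjI ballI allI impI)
  show "norm (poly (pcompose T A) z) \<le> M" if "z \<in> poly A -` K" for z
    using T that by (simp add: least_deviation_def poly_pcompose)
next
  fix g :: "complex poly" assume g: "degree g < k * degree A"
  then obtain k' where k: "k = Suc k'"
    by (cases k) auto
  define n where "n = degree A"
  obtain h where h: "degree h \<le> k'" "\<And>x. fibre_sum A g x = poly h x"
    using fibre_sum_poly[OF A] g unfolding k by blast
  have "degree (smult (1 / of_nat n) h) < k"
    using h(1) k by simp
  then obtain x where x: "x \<in> K" "M \<le> norm (poly (T + smult (1 / of_nat n) h) x)"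
    using T unfolding least_deviation_def by blast
  define Z where "Z = proots (A - [:x:])"
  have size: "size Z = n"
    by (simp add: Z_def n_def size_proots_diff_const)
  have "Z \<noteq> {#}"
    using size A by (auto simp: n_def)
  have "(\<Sum>w\<in>#Z. poly (pcompose T A + g) w) = (\<Sum>w\<in>#Z. poly T x + poly g w)"
    using in_proots_diff_const[OF A]
    by (intro arg_cong[of _ _ sum_mset] image_mset_cong) (simp add: poly_pcompose Z_def)
  also have "\<dots> = of_nat n * poly T x + poly h x"
    using h(2)[of x] by (simp add: sum_mset.distrib size fibre_sum_def Z_def[symmetric] sum_mset_constant)
  also have "\<dots> = of_nat n * poly (T + smult (1 / of_nat n) h) x"
    using A by (simp add: n_def algebra_simps)
  finally have "real n * M \<le> norm (\<Sum>w\<in>#Z. poly (pcompose T A + g) w)"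
    using x(2) by (simp add: norm_mult mult_left_mono)
  then have "\<exists>w\<in>#Z. M \<le> norm (poly (pcompose T A + g) w)"
    using norm_sum_mset_less[of Z "poly (pcompose T A + g)" M] \<open>Z \<noteq> {#}\<close> size by force
  then show "\<exists>w\<in>poly A -` K. M \<le> norm (poly (pcompose T A + g) w)"
    using in_proots_diff_const[OF A] x(1) by (auto simp: Z_def)
qed

section \<open>The curve of a common composite\<close>

text \<open>
  A bivariate polynomial is an element of \<open>\<complex>[x][y]\<close>: the outer variable is \<open>y\<close>.
\<close>

definition poly2 :: "'a::comm_ring_1 poly poly \<Rightarrow> 'a \<Rightarrow> 'a \<Rightarrow> 'a" where
  "poly2 P x y = poly (poly P [:y:]) x"

lemma poly2_simps [simp]:
  "poly2 0 x y = 0"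
  "poly2 1 x y = 1"
  "poly2 (P + Q) x y = poly2 P x y + poly2 Q x y"
  "poly2 (P - Q) x y = poly2 P x y - poly2 Q x y"
  "poly2 (P * Q) x y = poly2 P x y * poly2 Q x y"
  "poly2 (smult p P) x y = poly p x * poly2 P x y"
  "poly2 (pCons p P) x y = poly p x + y * poly2 P x y"
  by (simp_all add: poly2_def)

lemma poly2_map_poly [simp]: "poly2 (map_poly (\<lambda>c. [:c:]) p) x y = poly p y"
  by (induction p) (simp_all add: map_poly_pCons)

lemma poly2_altdef: "poly2 P x y = (\<Sum>j\<le>degree P. poly (coeff P j) x * y ^ j)"
  by (simp add: poly2_def poly_altdef[of P] poly_sum poly_power)

text \<open>The nonzero summand of largest degree cannot be cancelled.\<close>

lemma sum_distinct_degrees_eq_0: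
  fixes f :: "'i \<Rightarrow> 'a::comm_ring_1 poly"
  assumes fin: "finite I" and inj: "inj_on (\<lambda>i. degree (f i)) {i\<in>I. f i \<noteq> 0}"
    and sum: "(\<Sum>i\<in>I. f i) = 0" and i: "i \<in> I"
  shows "f i = 0"
proof (rule ccontr)
  assume "f i \<noteq> 0"
  define J where "J = {i\<in>I. f i \<noteq> 0}"
  have J: "finite J" "J \<noteq> {}"
    using fin i \<open>f i \<noteq> 0\<close> by (auto simp: J_def)
  obtain j where j: "j \<in> J" "\<And>i. i \<in> J \<Longrightarrow> degree (f i) \<le> degree (f j)"
    using Max_in[of "(\<lambda>i. degree (f i)) ` J"] Max_ge[of "(\<lambda>i. degree (f i)) ` J"] J by fastforce
  have "coeff (f i) (degree (f j)) = 0" if "i \<in> I - {j}" for i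
  proof (cases "f i = 0")
    case False
    then have "i \<in> J"
      using that by (simp add: J_def)
    then have "degree (f i) \<noteq> degree (f j)"
      using inj_onD[OF inj, of i j] that j(1) by (auto simp: J_def)
    then show ?thesis
      using j(2)[OF \<open>i \<in> J\<close>] by (intro coeff_eq_0) simp
  qed simp
  then have "coeff (\<Sum>i\<in>I. f i) (degree (f j)) = lead_coeff (f j)"
    using j(1) fin by (simp add: coeff_sum sum.remove[of I j] J_def)
  then show False
    using sum j(1) by (simp add: J_def)
qed

text \<open>Since \<open>j < n\<close>, the nonzero summands have pairwise distinct degrees.\<close>

lemma poly2_compose_eq_0_imp:
  fixes A B :: "'a::idom poly"
  assumes AB: "degree A = d * n" "degree B = d * m" and pos: "d > 0" "n > 0" and cop: "coprime n m"
    and deg: "degree P < n" and zero: "(\<Sum>j\<le>degree P. pcompose (coeff P j) A * B ^ j) = 0"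
  shows "P = 0"
proof -
  define f where "f j = pcompose (coeff P j) A * B ^ j" for j
  have degA: "degree A > 0"
    using AB pos by simp
  have deg_f: "degree (f j) = d * (n * degree (coeff P j) + m * j)" if "f j \<noteq> 0" for j
  proof -
    have "pcompose (coeff P j) A \<noteq> 0" "B ^ j \<noteq> 0"
      using that by (auto simp: f_def)
    then show ?thesis
      unfolding f_def using AB
      by (auto simp: degree_mult_eq degree_power_eq degree_pcompose algebra_simps power_0_left
          split: if_splits)
  qed
  \<comment> \<open>Coprimality makes \<open>n\<close> divide \<open>j - i\<close>, which is
    positive and below \<open>n\<close>.\<close>
  have less: False
    if "i < j" "j < n" and eq: "n * a + m * i = n * b + m * j" for i j a b
  proof -
    have "m * (j - i) + n * b = n * a"
      using that(1) eq by (simp add: diff_mult_distrib2)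
    then have "n dvd m * (j - i)"
      by (metis dvd_add_left_iff dvd_triv_left)
    then have "n dvd j - i"
      using cop by (simp add: coprime_dvd_mult_right_iff)
    then show False
      using that(1,2) by (auto dest: dvd_imp_le)
  qed
  have inj: "inj_on (\<lambda>j. degree (f j)) {j \<in> {..degree P}. f j \<noteq> 0}"
  proof (rule inj_onI)
    fix i j assume i: "i \<in> {j \<in> {..degree P}. f j \<noteq> 0}" and j: "j \<in> {j \<in> {..degree P}. f j \<noteq> 0}"
      and eq: "degree (f i) = degree (f j)"
    then have "n * degree (coeff P i) + m * i = n * degree (coeff P j) + m * j"
      using pos(1) by (simp add: deg_f)
    then show "i = j"
      using less[of i j] less[of j i] i j deg by (metis (lifting) atMost_iff le_less_trans linorder_neqE_nat mem_Collect_eq)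
  qed
  have B0: "B \<noteq> 0 \<or> m = 0"
    using AB(2) pos by auto
  show "P = 0"
  proof (rule ccontr)
    assume "P \<noteq> 0"
    have "f (degree P) = 0"
      using zero by (intro sum_distinct_degrees_eq_0[OF _ inj]) (simp_all add: f_def)
    then have "pcompose (lead_coeff P) A = 0 \<or> B ^ degree P = 0"
      by (simp add: f_def)
    moreover have "pcompose (lead_coeff P) A \<noteq> 0"
      using \<open>P \<noteq> 0\<close> degA by (simp add: pcompose_eq_0_iff)
    \<comment> \<open>If \<open>B = 0\<close> then \<open>m = 0\<close>, so coprimality leaves
      \<open>n = 1\<close> and \<open>degree P = 0\<close>, where the power is 1.\<close>
    moreover have "B ^ degree P \<noteq> 0"
    proof
      assume *: "B ^ degree P = 0"
      then have "m = 0" "degree P > 0"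
        using B0 AB(2) by (auto intro: Nat.gr0I)
      then show False
        using cop deg by simp
    qed
    ultimately show False
      by blast
  qed
qed

text \<open>Repeated division by \<open>A\<close>, grouped by powers of the variable. It gives the
  finite generation over polynomials in \<open>A\<close> on which the Nakayama argument below
  rests.\<close>

lemma poly_adic_expansion:
  fixes A :: "'a::field poly"
  assumes "degree A > 0"
  shows "\<exists>u. g = (\<Sum>i<degree A. pcompose (u i) A * monom 1 i)"
proof (induction "degree g" arbitrary: g rule: less_induct)
  case less
  show ?case
  proof (cases "degree g < degree A")
    case True
    have "g = (\<Sum>i<degree A. monom (coeff g i) i)"
      using True by (intro poly_eqI) (auto simp: coeff_sum coeff_eq_0)
    then show ?thesis
      by (intro exI[of _ "\<lambda>i. [:coeff g i:]"]) (simp add: pcompose_pCons smult_monom)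
  next
    case False
    define q r where "q = g div A" and "r = g mod A"
    have g: "g = q * A + r"
      by (simp add: q_def r_def)
    have r: "degree r < degree A"
      unfolding r_def using assms by (metis degree_0 degree_mod_less less_numeral_extra(3))
    have "q \<noteq> 0"
      using False r g by auto
    then have "degree (q * A) = degree q + degree A"
      using assms by (intro degree_mult_eq) auto
    moreover have "degree (q * A) \<le> degree g"
      using degree_diff_le[of g "degree g" r] r False g by simp
    ultimately have "degree q < degree g" "degree r < degree g"
      using r assms False by linarith+
    then obtain u v where u: "q = (\<Sum>i<degree A. pcompose (u i) A * monom 1 i)"
      and v: "r = (\<Sum>i<degree A. pcompose (v i) A * monom 1 i)"
      using less by metis
    have "g = A * (\<Sum>i<degree A. pcompose (u i) A * monom 1 i) + (\<Sum>i<degree A. pcompose (v i) A * monom 1 i)"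
      using g u v by (simp add: mult.commute)
    also have "\<dots> = (\<Sum>i<degree A. pcompose (pCons 0 (u i) + v i) A * monom 1 i)"
      by (simp add: sum_distrib_left sum.distrib[symmetric] pcompose_add pcompose_pCons algebra_simps)
    finally show ?thesis
      by (intro exI[of _ "\<lambda>i. pCons 0 (u i) + v i"])
  qed
qed

lemma bezout_if_no_common_root:
  fixes p q :: "complex poly"
  assumes "\<And>z. poly p z = 0 \<Longrightarrow> poly q z \<noteq> 0"
  shows "\<exists>u v. u * p + v * q = 1"
proof -
  have "degree (gcd p q) = 0"
  proof (rule ccontr)
    assume "degree (gcd p q) \<noteq> 0"
    then obtain z where "poly (gcd p q) z = 0"
      using alg_closed_imp_poly_has_root by blast
    then have "poly p z = 0" "poly q z = 0"
      by (metis gcd_dvd1 gcd_dvd2 dvdE mult_zero_left poly_mult)+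
    then show False
      using assms by blast
  qed
  moreover have "gcd p q \<noteq> 0"
    using assms[of 0] by auto
  ultimately have "is_unit (gcd p q)"
    using is_unit_iff_degree by blast
  then have "coprime p q"
    by (rule is_unit_gcd[THEN iffD1])
  then have "gcd p q = 1"
    by simp
  then show ?thesis
    by (metis bezout_coefficients_fst_snd)
qed

text \<open>
  Nakayama's lemma for the \<open>\<complex>[A, B]\<close>-module \<open>\<complex>[z]\<close> and the ideal of the point \<open>(x, y)\<close>:
  the generators \<open>1, z, \<dots>, z\<^bsup>n-1\<^esup>\<close> are eliminated one after the other.
\<close>

lemma annihilator_if_not_in_image:
  fixes A B :: "complex poly"
  assumes A: "degree A > 0" and no: "\<And>z. poly A z = x \<Longrightarrow> poly B z \<noteq> y"
  shows "\<exists>r. poly2 r x y = 1 \<and> (\<forall>z. poly2 r (poly A z) (poly B z) = 0)"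
proof -
  define ev where "ev r z = poly2 r (poly A z) (poly B z)" for r z
  have ev_simps: "ev 1 z = 1" "ev (P + Q) z = ev P z + ev Q z" "ev (P - Q) z = ev P z - ev Q z"
    "ev (P * Q) z = ev P z * ev Q z" for P Q z
    by (simp_all add: ev_def)
  \<comment> \<open>The ideal of the point \<open>(x, y)\<close> generates the unit ideal of
    polynomials in \<open>z\<close>, since \<open>A - x\<close> and \<open>B - y\<close> have no
    common root.\<close>
  obtain U V where UV: "U * (A - [:x:]) + V * (B - [:y:]) = 1"
    using bezout_if_no_common_root[of "A - [:x:]" "B - [:y:]"] no by auto
  \<comment> \<open>After \<open>l\<close> eliminations, multiplication by \<open>r\<close> maps
    every polynomial into the ideal of the point times the remaining \<open>degree A - l\<close>
    powers.\<close>
  have "\<exists>r. poly2 r x y = 1 \<and> (\<forall>g. \<exists>c. (\<forall>i. poly2 (c i) x y = 0) \<and>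
           (\<forall>z. ev r z * poly g z = (\<Sum>i<degree A - l. ev (c i) z * z ^ i)))" (is "\<exists>r. ?Q l r")
    if "l \<le> degree A" for l
    using that
  proof (induction l)
    case 0
    have "\<exists>c. (\<forall>i. poly2 (c i) x y = 0) \<and>
           (\<forall>z. ev 1 z * poly g z = (\<Sum>i<degree A - 0. ev (c i) z * z ^ i))" for g
    proof -
      obtain u where u: "g * U = (\<Sum>i<degree A. pcompose (u i) A * monom 1 i)"
        using poly_adic_expansion[OF A] by blast
      obtain v where v: "g * V = (\<Sum>i<degree A. pcompose (v i) A * monom 1 i)"
        using poly_adic_expansion[OF A] by blast
      define c where "c i = [:u i * [:- x, 1:]:] + [:v i:] * [:[:- y:], 1:]" for i
      have "poly g z = (\<Sum>i<degree A. ev (c i) z * z ^ i)" for z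
      proof -
        have "poly g z = poly (g * U) z * (poly A z - x) + poly (g * V) z * (poly B z - y)"
          using arg_cong[OF UV, of "\<lambda>p. poly g z * poly p z"] by (simp add: algebra_simps)
        also have "\<dots> = (\<Sum>i<degree A. poly (u i) (poly A z) * z ^ i * (poly A z - x)
            + poly (v i) (poly A z) * z ^ i * (poly B z - y))"
          unfolding u v sum.distrib sum_distrib_right by (simp add: poly_sum poly_pcompose poly_monom sum_distrib_right)
        also have "\<dots> = (\<Sum>i<degree A. ev (c i) z * z ^ i)"
          by (intro sum.cong) (simp_all add: ev_def c_def algebra_simps)
        finally show ?thesis .
      qed
      moreover have "poly2 (c i) x y = 0" for i
        by (simp add: c_def)
      ultimately show ?thesis
        by (intro exI[of _ c]) (simp add: ev_simps)
    qed
    then show ?case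
      by (intro exI[of _ 1]) simp
  next
    case (Suc l)
    define k where "k = degree A - Suc l"
    have k: "degree A - l = Suc k"
      using Suc.prems by (simp add: k_def)
    obtain r where r: "poly2 r x y = 1" and
      rg: "\<And>g. \<exists>c. (\<forall>i. poly2 (c i) x y = 0) \<and> (\<forall>z. ev r z * poly g z = (\<Sum>i<Suc k. ev (c i) z * z ^ i))"
      using Suc unfolding k by auto
    obtain c where c: "\<And>i. poly2 (c i) x y = 0"
      and cz: "\<And>z. ev r z * z ^ k = (\<Sum>i<Suc k. ev (c i) z * z ^ i)"
      using rg[of "monom 1 k"] by (auto simp: poly_monom)
    \<comment> \<open>Moving the \<open>z ^ k\<close> term to the left expresses
      \<open>s * z ^ k\<close> through lower powers; \<open>s\<close> is still 1 at the point
      because \<open>c k\<close> vanishes there.\<close>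
    define s where "s = r - c k"
    have s: "ev s z * z ^ k = (\<Sum>i<k. ev (c i) z * z ^ i)" for z
      using cz[of z] by (simp add: s_def ev_simps algebra_simps)
    have "\<exists>e. (\<forall>i. poly2 (e i) x y = 0) \<and> (\<forall>z. ev (s * r) z * poly g z = (\<Sum>i<k. ev (e i) z * z ^ i))" for g
    proof -
      obtain b where b: "\<And>i. poly2 (b i) x y = 0"
        and bz: "\<And>z. ev r z * poly g z = (\<Sum>i<Suc k. ev (b i) z * z ^ i)"
        using rg[of g] by blast
      have "ev (s * r) z * poly g z = (\<Sum>i<k. ev (s * b i + b k * c i) z * z ^ i)" for z
      proof -
        have "ev (s * r) z * poly g z = ev s z * (\<Sum>i<Suc k. ev (b i) z * z ^ i)"
          using bz[of z] by (simp add: ev_simps)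
        also have "\<dots> = ev s z * (\<Sum>i<k. ev (b i) z * z ^ i) + ev (b k) z * (ev s z * z ^ k)"
          by (simp add: algebra_simps)
        also have "\<dots> = (\<Sum>i<k. ev (s * b i + b k * c i) z * z ^ i)"
          unfolding s by (simp add: ev_simps sum_distrib_left sum.distrib[symmetric] algebra_simps)
        finally show ?thesis .
      qed
      then show ?thesis
        using b c by (intro exI[of _ "\<lambda>i. s * b i + b k * c i"]) simp
    qed
    then show ?case
      unfolding k_def[symmetric] using r c by (intro exI[of _ "s * r"]) (simp add: s_def)
  qed
  \<comment> \<open>No powers remain, so \<open>r\<close> kills every polynomial;
    \<open>g = 1\<close> shows that it vanishes along the curve.\<close>
  from this[of "degree A"] obtain r where r: "poly2 r x y = 1"
    and "\<And>g z. ev r z * poly g z = 0"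
    by auto
  from this(2)[of _ 1] show ?thesis
    using r by (auto simp: ev_def)
qed

text \<open>A point missed by the parametrisation would have an \<open>r\<close> that is 1 there but
  zero along the parametrisation. Dividing \<open>r\<close> by \<open>D(Y) - C(X)\<close> leaves a
  remainder whose degree in \<open>Y\<close> is too small to vanish along it unless it is zero.
  Hence a nonzero constant multiple of \<open>r\<close> is divisible by \<open>D(Y) - C(X)\<close>
  and vanishes at the point.\<close>

lemma common_composite_lying_over:
  fixes A B C D :: "complex poly"
  assumes comp: "pcompose C A = pcompose D B"
    and AB: "degree A > 0" "degree B > 0"
    and D: "degree D = degree A div gcd (degree A) (degree B)"
    and xy: "poly C x = poly D y"
  obtains z where "poly A z = x" "poly B z = y"
proof (rule ccontr)
  assume "\<not> thesis"
  then have "\<And>z. poly A z = x \<Longrightarrow> poly B z \<noteq> y"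
    using that by blast
  then obtain r where r: "poly2 r x y = 1" "\<And>z. poly2 r (poly A z) (poly B z) = 0"
    using annihilator_if_not_in_image[OF AB(1)] by blast
  define d where "d = gcd (degree A) (degree B)"
  define n where "n = degree A div d"
  define m where "m = degree B div d"
  have d: "d > 0"
    using AB by (simp add: d_def)
  have deg: "degree A = d * n" "degree B = d * m"
    by (simp_all add: n_def m_def d_def)
  have "n > 0"
    using AB(1) deg(1) by (intro gr0I) auto
  have cop: "coprime n m"
    unfolding n_def m_def d_def using AB by (intro div_gcd_coprime) auto
  \<comment> \<open>This is \<open>D(Y) - C(X)\<close> as a polynomial in \<open>Y\<close>. As
    \<open>n > 0\<close>, its leading coefficient is the nonzero constant of \<open>D\<close>, so
    pseudo-division costs only a power of that constant.\<close>
  define Q where "Q = map_poly (\<lambda>c. [:c:]) D - [:C:]"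
  have cQ: "coeff Q i = (if i = 0 then [:coeff D 0:] - C else [:coeff D i:])" for i
    by (cases i) (simp_all add: Q_def coeff_map_poly)
  have "degree D = n"
    using D by (simp add: n_def d_def)
  then have "degree Q \<le> n" "coeff Q n = [:lead_coeff D:]"
    using \<open>n > 0\<close> by (auto simp: cQ coeff_eq_0 intro!: degree_le)
  moreover have "lead_coeff D \<noteq> 0"
    using \<open>degree D = n\<close> \<open>n > 0\<close> by auto
  ultimately have degQ: "degree Q = n" and lcQ: "lead_coeff Q = [:lead_coeff D:]" and "Q \<noteq> 0"
    using le_degree[of Q n] by auto
  obtain q s where qs: "pseudo_divmod r Q = (q, s)"
    by force
  define e where "e = Suc (degree r) - degree Q"
  have div: "smult ([:lead_coeff D:] ^ e) r = Q * q + s" and "s = 0 \<or> degree s < degree Q"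
    using pseudo_divmod[OF \<open>Q \<noteq> 0\<close> qs] by (simp_all add: lcQ e_def)
  then have "degree s < n"
    using degQ \<open>n > 0\<close> by auto
  have Qz: "poly2 Q (poly A z) (poly B z) = 0" for z
    using arg_cong[OF comp, of "\<lambda>p. poly p z"] by (simp add: Q_def poly_pcompose)
  have sz: "poly2 s (poly A z) (poly B z) = 0" for z
    using arg_cong[OF div, of "\<lambda>P. poly2 P (poly A z) (poly B z)"] r(2) Qz by simp
  have "(\<Sum>j\<le>degree s. pcompose (coeff s j) A * B ^ j) = 0"
    using sz by (intro poly_eq_poly_eq_iff[THEN iffD1]) (simp add: fun_eq_iff poly2_altdef poly_sum poly_pcompose poly_power)
  then have "s = 0"
    by (rule poly2_compose_eq_0_imp[OF deg d \<open>n > 0\<close> cop \<open>degree s < n\<close>])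
  then have "lead_coeff D ^ e = 0"
    using arg_cong[OF div, of "\<lambda>P. poly2 P x y"] r(1) xy by (simp add: Q_def poly_const_pow)
  then show False
    using \<open>lead_coeff D \<noteq> 0\<close> by simp
qed

section \<open>Polynomials sharing preimages of compact sets\<close>

lemma surj_poly_complex:
  fixes P :: "complex poly"
  assumes "degree P > 0"
  shows "surj (poly P)"
proof -
  have "\<exists>z. poly P z = x" for x
  proof -
    have "degree (P - [:x:]) > 0"
      using assms by (cases P) simp
    then show ?thesis
      using alg_closed_imp_poly_has_root[of "P - [:x:]"] by auto
  qed
  then show ?thesis
    by (metis surj_def)
qed

lemma common_composite_exists:
  fixes A B :: "complex poly"
  assumes AB: "degree A > 0" "degree B > 0"
    and K: "compact K" "compact L" "compact (poly A -` K)" "infinite K"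
    and eq: "poly A -` K = poly B -` L"
  obtains C D where "pcompose C A = pcompose D B"
    "degree C = degree B div gcd (degree A) (degree B)"
    "degree D = degree A div gcd (degree A) (degree B)"
proof -
  define n m d where "n = degree A" and "m = degree B" and "d = gcd n m"
  define N where "N = lcm n m"
  have N: "m div d * n = N" "n div d * m = N"
    by (simp_all add: N_def d_def lcm_nat_def div_mult_swap dvd_div_mult mult.commute)
  have pos: "m div d > 0" "n div d > 0" "N > 0"
    using AB by (simp_all add: n_def m_def d_def N_def div_greater_zero_iff dvd_imp_le lcm_pos_nat)
  have "K = poly A ` (poly A -` K)"
    using surj_poly_complex[OF AB(1)] by (simp add: surj_image_vimage_eq)
  then have infin: "infinite (poly A -` K)"
    using K(4) by (metis finite_imageI)
  \<comment> \<open>Fibres of \<open>B\<close> are finite, so infinitude passes from the common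
    preimage to \<open>L\<close>.\<close>
  have "finite (poly B -` {y})" for y
  proof -
    have "B - [:y:] \<noteq> 0"
      using AB(2) by auto
    then have "finite {z. poly (B - [:y:]) z = 0}"
      by (rule poly_roots_finite)
    then show ?thesis
      by (simp add: vimage_def)
  qed
  then have "finite (poly B -` L)" if "finite L"
    using finite_UN_I[OF that, of "\<lambda>y. poly B -` {y}"] by (metis vimage_eq_UN)
  then have infL: "infinite L"
    using infin eq by auto
  \<comment> \<open>The leading coefficient is chosen to make the composite monic; then the two
    composites differ in degree below \<open>N\<close>.\<close>
  have *: "\<exists>C M. degree C = k \<and> lead_coeff (pcompose C P) = 1 \<and> least_deviation X k C M"
    if X: "compact X" "infinite X" and k: "k > 0" and P: "degree P > 0"
    for k P and X :: "complex set"
  proof -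
    define a where "a = 1 / lead_coeff P ^ k"
    have "lead_coeff P \<noteq> 0"
      using P by auto
    then have a: "a \<noteq> 0" "a * lead_coeff P ^ k = 1"
      by (simp_all add: a_def)
    obtain g M where g: "degree g < k" "least_deviation X k (monom a k + g) M"
      using least_deviation_exists[OF X k] by blast
    have "degree (monom a k + g) = k" "lead_coeff (monom a k + g) = a"
      using g(1) a(1) by (simp_all add: degree_add_eq_left degree_monom_eq coeff_eq_0)
    moreover from this have "lead_coeff (pcompose (monom a k + g) P) = 1"
      using lead_coeff_comp[of P "monom a k + g"] P a(2) by simp
    ultimately show ?thesis
      using g(2) by blast
  qed
  obtain C M where C: "degree C = m div d" "lead_coeff (pcompose C A) = 1"
      "least_deviation K (m div d) C M"
    using *[OF K(1,4) pos(1) AB(1)] by blast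
  obtain D M' where D: "degree D = n div d" "lead_coeff (pcompose D B) = 1"
      "least_deviation L (n div d) D M'"
    using *[OF K(2) infL pos(2) AB(2)] by blast
  have deg: "degree (pcompose C A) = N" "degree (pcompose D B) = N"
    using C(1) D(1) N by (simp_all add: degree_pcompose n_def m_def)
  have "degree (pcompose C A - pcompose D B) < N"
  proof (rule degree_lessI)
    show "\<forall>k\<ge>N. coeff (pcompose C A - pcompose D B) k = 0"
    proof (intro allI impI)
      fix k assume "N \<le> k"
      then show "coeff (pcompose C A - pcompose D B) k = 0"
        using C(2) D(2) deg by (cases "k = N") (simp_all add: coeff_eq_0)
    qed
  qed (use pos in simp)
  moreover have "least_deviation (poly A -` K) N (pcompose C A) M"
    using least_deviation_pcompose[OF C(3) AB(1)] N(1) by (simp add: n_def)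
  moreover have "least_deviation (poly A -` K) N (pcompose D B) M'"
    using least_deviation_pcompose[OF D(3) AB(2)] N(2) by (simp add: m_def eq)
  ultimately have "pcompose C A = pcompose D B"
    using least_deviation_unique[OF K(3) infin] by blast
  then show ?thesis
    using that C(1) D(1) by (simp add: n_def m_def d_def)
qed

section \<open>The Riemann sphere\<close>

lemma Hausdorff_space_riemann_sphere: "Hausdorff_space riemann_sphere"
  by (simp add: Hausdorff_space_Alexandroff_compactification locally_compact_space_euclidean)

lemma surj_sphere_poly:
  assumes "degree P > 0"
  shows "surj (sphere_poly P)"
proof -
  have "\<exists>x. sphere_poly P x = w" for w
  proof (cases w)
    case None
    then show ?thesis
      using assms by (intro exI[of _ None]) simp
  next
    case (Some y)
    then show ?thesis
      using surjD[OF surj_poly_complex[OF assms], of y] by (metis sphere_poly.simps(1))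
  qed
  then show ?thesis
    by (metis surj_def)
qed

text \<open>A continuous map from a compact to a Hausdorff space is closed, and a closed continuous
  surjection is a quotient map.\<close>

lemma quotient_map_sphere_poly:
  assumes "degree P > 0"
  shows "quotient_map riemann_sphere riemann_sphere (sphere_poly P)"
proof (rule continuous_closed_imp_quotient_map)
  show "closed_map riemann_sphere riemann_sphere (sphere_poly P)"
    by (rule continuous_imp_closed_map[OF continuous_map_sphere_poly _ Hausdorff_space_riemann_sphere]) simp
  show "sphere_poly P ` topspace riemann_sphere = topspace riemann_sphere"
    unfolding topspace_riemann_sphere by (rule surj_sphere_poly[OF assms])
qed (rule continuous_map_sphere_poly)

lemma compact_Some_vimage_Compl:
  assumes "openin riemann_sphere V" "None \<in> V"
  shows "compact (Some -` (- V))"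
proof -
  obtain C where C: "compact C" "V = insert None (Some ` (- C))"
    using assms by (auto simp: openin_Alexandroff_compactification Compl_eq_Diff_UNIV)
  then have "Some -` (- V) = C"
    by auto
  then show ?thesis
    using C by simp
qed

lemma open_Some_vimage:
  assumes "openin riemann_sphere V"
  shows "open (Some -` V)"
  using openin_continuous_map_preimage[OF continuous_map_Some assms] by (simp add: vimage_def)

lemma vimage_openin:
  assumes "continuous_map riemann_sphere riemann_sphere F" "openin riemann_sphere V"
  shows "openin riemann_sphere (F -` V)"
  using openin_continuous_map_preimage[OF assms]
  unfolding topspace_riemann_sphere by (simp add: vimage_def)

theorem mainTheorem1:
  fixes A B :: "complex poly"
    and F G :: "complex option \<Rightarrow> complex option"
  assumes "degree A > 0 \<or> degree B > 0"
    and "continuous_map riemann_sphere riemann_sphere F"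
    and "continuous_map riemann_sphere riemann_sphere G"
    and "\<not> F constant_on UNIV"
    and "\<not> G constant_on UNIV"
    and "\<forall>z. F (sphere_poly A z) = G (sphere_poly B z)"
  shows "\<exists>C D :: complex poly.
           (\<forall>z. sphere_poly C (sphere_poly A z) = sphere_poly D (sphere_poly B z)) \<and>
           (\<exists>H. continuous_map riemann_sphere riemann_sphere H \<and>
                (\<forall>z. F z = H (sphere_poly C z)) \<and>
                (\<forall>z. G z = H (sphere_poly D z)))"
proof -
  note contF = assms(2) and contG = assms(3)
  have FG: "F (sphere_poly A z) = G (sphere_poly B z)" for z
    using assms(6) by blast
  have const: "sphere_poly P z = Some (poly P 0)" if "degree P = 0" for P z
    using that by (cases z) (auto elim!: degree_eq_zeroE)
  \<comment> \<open>A constant \<open>A\<close> would leave \<open>B\<close> nonconstant, hence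
    surjective, and force \<open>G\<close> to be constant.\<close>
  have A: "degree A > 0"
  proof (rule ccontr)
    assume "\<not> degree A > 0"
    then have "degree A = 0" "degree B > 0"
      using assms(1) by auto
    then have "G w = F (Some (poly A 0))" for w
      using surjD[OF surj_sphere_poly, of B w] FG const[of A] by metis
    then show False
      using assms(5) by (auto simp: constant_on_def)
  qed
  have B: "degree B > 0"
  proof (rule ccontr)
    assume "\<not> degree B > 0"
    then have "F w = G (Some (poly B 0))" for w
      using surjD[OF surj_sphere_poly[OF A], of w] FG const[of B] by (metis gr0I)
    then show False
      using assms(4) by (auto simp: constant_on_def)
  qed
  have None_eq: "F None = G None"
    using FG[of None] A B by simp
  obtain x where x: "F x \<noteq> F None"
    using assms(4) by (auto simp: constant_on_def)
  then obtain a where a: "x = Some a"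
    by (cases x) auto
  \<comment> \<open>The complement of \<open>V\<close> is the closed set defining \<open>K\<close>
    and \<open>L\<close>. It contains \<open>U\<close>, whose nonempty open preimage will make
    \<open>K\<close> infinite.\<close>
  obtain U V where U: "openin riemann_sphere U" "F x \<in> U"
    and V: "openin riemann_sphere V" "F None \<in> V" and UV: "disjnt U V"
    using Hausdorff_space_riemann_sphere x
    unfolding Hausdorff_space_def topspace_riemann_sphere by blast
  define K where "K = Some -` (- (F -` V))"
  define L where "L = Some -` (- (G -` V))"
  have comp: "compact K" "compact L"
    unfolding K_def L_def using V None_eq
    by (auto intro!: compact_Some_vimage_Compl vimage_openin contF contG)
  \<comment> \<open>The preimage of \<open>K\<close> under \<open>A\<close> arises from this
    composite as \<open>K\<close> does from \<open>F\<close>, so it is compact for the same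
    reason.\<close>
  have "continuous_map riemann_sphere riemann_sphere (F \<circ> sphere_poly A)"
    by (rule continuous_map_compose[OF continuous_map_sphere_poly contF])
  then have "compact (Some -` (- ((F \<circ> sphere_poly A) -` V)))"
    using V A by (intro compact_Some_vimage_Compl vimage_openin) auto
  moreover have "Some -` (- ((F \<circ> sphere_poly A) -` V)) = poly A -` K"
    by (auto simp: K_def)
  ultimately have comp': "compact (poly A -` K)"
    by simp
  have "open (Some -` (F -` U))" "a \<in> Some -` (F -` U)"
    using U a by (auto intro!: open_Some_vimage vimage_openin contF)
  then have "infinite (Some -` (F -` U))"
    using finite_imp_not_open by blast
  moreover have "Some -` (F -` U) \<subseteq> K"
    using UV by (auto simp: K_def disjnt_iff)
  ultimately have infin: "infinite K"
    using finite_subset by blast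
  have "poly A -` K = poly B -` L"
    using FG[of "Some _"] by (auto simp: K_def L_def)
  then obtain C D where CD: "pcompose C A = pcompose D B"
      "degree C = degree B div gcd (degree A) (degree B)"
      "degree D = degree A div gcd (degree A) (degree B)"
    using common_composite_exists[OF A B comp comp' infin] by blast
  have degC: "degree C > 0" and degD: "degree D > 0"
    using A B by (simp_all add: CD(2,3) div_greater_zero_iff dvd_imp_le)
  have CD_eq: "sphere_poly C (sphere_poly A z) = sphere_poly D (sphere_poly B z)" for z
    using A B degC degD arg_cong[OF CD(1), of "\<lambda>P. poly P (the z)"]
    by (cases z) (auto simp: poly_pcompose)
  \<comment> \<open>Finite points have a common parameter \<open>z\<close>; over infinity,
    \<open>C\<close> and \<open>D\<close> have only infinity itself.\<close>
  have F_eq_G: "F v = G w" if "sphere_poly C v = sphere_poly D w" for v w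
  proof (cases "v = None \<or> w = None")
    case True
    then have "v = None \<and> w = None"
      using that degC degD by (cases v; cases w) auto
    then show ?thesis
      by (simp add: None_eq)
  next
    case False
    then obtain p q where vw: "v = Some p" "w = Some q"
      by auto
    then have "poly C p = poly D q"
      using that by simp
    then obtain z where "poly A z = p" "poly B z = q"
      by (rule common_composite_lying_over[OF CD(1) A B CD(3)])
    then show ?thesis
      using FG[of "Some z"] vw by simp
  qed
  \<comment> \<open>An arbitrary preimage under \<open>C\<close> is chosen; \<open>F_eq_G\<close>
    will show that the choice does not matter.\<close>
  define H where "H w = F (SOME v. sphere_poly C v = w)" for w
  have H: "sphere_poly C (SOME v. sphere_poly C v = w) = w" for w
    using surjD[OF surj_sphere_poly[OF degC], of w] by (metis (mono_tags) someI_ex)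
  have GH: "G w = H (sphere_poly D w)" for w
    unfolding H_def by (rule F_eq_G[OF H, symmetric])
  \<comment> \<open>As \<open>F_eq_G\<close> relates \<open>F\<close> only to \<open>G\<close>, two
    preimages under \<open>C\<close> are compared through a point \<open>w\<close> with the same
    image under \<open>D\<close>.\<close>
  have FH: "F v = H (sphere_poly C v)" for v
  proof -
    obtain w where "sphere_poly D w = sphere_poly C v"
      using surjD[OF surj_sphere_poly[OF degD]] by metis
    then show ?thesis
      using F_eq_G[of v w] GH[of w] by simp
  qed
  have "H \<circ> sphere_poly C = F"
    using FH by auto
  then have "continuous_map riemann_sphere riemann_sphere H"
    using continuous_compose_quotient_map[OF quotient_map_sphere_poly[OF degC]] contF by metis
  then show ?thesis
    using CD_eq FH GH by blast
qed

end
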